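(* Let $H$ be a Hénon map and for $c>0$ let $$\Omega_c=\{z\in\mathbb{C}^2: G_H^+(z)<c\}.$$ Then $\Omega_c$ is not Reinhardt for any $c>0$.
   Context: A Hénon map is a polynomial automorphism of $\mathbb{C}^2$ of the form $H=H_m\circ\cdots\circ H_1$ ($m\ge 1$) where $H_j(x,y)=(b_j y,\, p_j(y)-\delta_j x)$ with $p_j$ a polynomial of degree $d_j\ge 2$ and $b_j\delta_j\neq 0$. Its degree is $d=d_1\cdots d_m$. The Green's function of $H$ is $$G_H^+(z)=\lim_{n\to\infty}\frac{1}{d^n}\log^+\|H^n(z)\|,\qquad z\in\mathbb{C}^2.$$ A domain $\Omega\subset\mathbb{C}^2$ is Reinhardt if $(e^{i\theta_1}x,e^{i\theta_2}y)\in\Omega$ for all $(x,y)\in\Omega$ and all $\theta_1,\theta_2\in\mathbb{R}$. *)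

theory Defs
  imports
    "HOL-Complex_Analysis.Complex_Analysis"
    "HOL-Computational_Algebra.Polynomial"
begin

text \<open>\<open>\<complex>\<^sup>2\<close> is the type \<^typ>\<open>complex \<times> complex\<close>; its library norm is the Euclidean one.\<close>

type_synonym C2 = "complex \<times> complex"

definition henon_factor :: "complex \<Rightarrow> complex poly \<Rightarrow> complex \<Rightarrow> C2 \<Rightarrow> C2" where
  "henon_factor b p \<delta> = (\<lambda>(x, y). (b * y, poly p y - \<delta> * x))"

text \<open>
  The relation \<open>henon_map H d\<close> says that \<open>H\<close> is a Henon map of degree \<open>d\<close>. The degree is read off
  from the factors \<open>H\<^sub>m \<circ> \<dots> \<circ> H\<^sub>1\<close>, so it is carried along as an argument.
\<close>

definition henon_map :: "(C2 \<Rightarrow> C2) \<Rightarrow> nat \<Rightarrow> bool" where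
  "henon_map H d \<longleftrightarrow>
     (\<exists>(m::nat) b p \<delta>. m \<ge> 1
        \<and> (\<forall>j\<in>{1..m}. degree (p j) \<ge> 2 \<and> b j * \<delta> j \<noteq> 0)
        \<and> H = fold (\<lambda>j F. henon_factor (b j) (p j) (\<delta> j) \<circ> F) [1..<Suc m] id
        \<and> d = (\<Prod>j=1..m. degree (p j)))"

text \<open>Since \<open>ln 0 = 0\<close> in the library, \<open>log_plus 0 = 0\<close> as it should be.\<close>

definition log_plus :: "real \<Rightarrow> real" where
  "log_plus t = max 0 (ln t)"

definition green_plus :: "(C2 \<Rightarrow> C2) \<Rightarrow> nat \<Rightarrow> C2 \<Rightarrow> real" where
  "green_plus H d z = lim (\<lambda>n. 1 / real d ^ n * log_plus (norm ((H ^^ n) z)))"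

text \<open>
  Invariance under the torus action, for an arbitrary set. Openness and connectedness are
  deliberately not part of the predicate, so that its negation really is failure of the invariance.
\<close>

definition reinhardt :: "C2 set \<Rightarrow> bool" where
  "reinhardt \<Omega> \<longleftrightarrow>
     (\<forall>x y. (x, y) \<in> \<Omega> \<longrightarrow>
        (\<forall>\<theta>\<^sub>1 \<theta>\<^sub>2 :: real. (exp (\<i> * of_real \<theta>\<^sub>1) * x, exp (\<i> * of_real \<theta>\<^sub>2) * y) \<in> \<Omega>))"

end

theory Submission
  imports Defs "HOL-Real_Asymp.Real_Asymp"
    "HOL-Computational_Algebra.Fundamental_Theorem_Algebra"
begin

text \<open>
  Put \<open>u\<^sub>n = (log\<^sup>+ \<parallel>H\<^sup>n\<parallel> + C) / d\<^sup>n\<close>, where \<open>log\<^sup>+ \<parallel>H z\<parallel> \<le> d log\<^sup>+ \<parallel>z\<parallel> + C\<close>. These functions decrease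
  to the Green function \<open>G\<close>. Two facts follow from the usual filtration of a Henon map:
  \<open>G (x, 0)\<close> is unbounded in \<open>x\<close>, and every line \<open>{x} \<times> \<complex>\<close> meets \<open>{G < c}\<close>, because the points
  where the second coordinate of \<open>H\<^sup>n (x, \<cdot>)\<close> vanishes have an orbit that up to time
  \<open>n\<close> stays in a ball depending only on \<open>x\<close>. If \<open>{G < c}\<close> is Reinhardt, then it contains a whole circle
  \<open>{x} \<times> {\<bar>y\<bar> = r}\<close>. By Dini's argument \<open>u\<^sub>n < c\<close> on this circle for all large \<open>n\<close>, and the maximum
  principle for the polynomials \<open>H\<^sup>n (x, \<cdot>)\<close> gives \<open>G (x, 0) \<le> c\<close> for every \<open>x\<close>, a contradiction.
\<close>

section \<open>Elementary estimates for \<open>log_plus\<close> and for polynomials in one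
  variable\<close>

lemma log_plus_eq: "t \<ge> 0 \<Longrightarrow> log_plus t = ln (max 1 t)"
  by (cases "t = 0") (auto simp: log_plus_def max_def)

lemma log_plus_nonneg: "log_plus t \<ge> 0"
  by (simp add: log_plus_def)

lemma log_plus_mono: "0 \<le> s \<Longrightarrow> s \<le> t \<Longrightarrow> log_plus s \<le> log_plus t"
  by (simp add: log_plus_eq)

lemma le_exp_log_plus: "t \<ge> 0 \<Longrightarrow> t \<le> exp (log_plus t)"
  by (simp add: log_plus_eq)

text \<open>Writing the function with \<open>max 1\<close> keeps the argument of \<open>ln\<close>
  away from 0, so zeros of \<open>f\<close> do no harm.\<close>

lemma continuous_on_log_plus_norm:
  fixes f :: "'a::topological_space \<Rightarrow> 'b::real_normed_vector"
  assumes "continuous_on S f"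
  shows "continuous_on S (\<lambda>w. log_plus (norm (f w)))"
proof -
  have "continuous_on S (\<lambda>w. ln (max 1 (norm (f w))))"
    by (intro continuous_intros assms) auto
  then show ?thesis
    by (simp add: log_plus_eq)
qed

lemma norm_poly_le_power:
  fixes p :: "'a::real_normed_field poly"
  assumes "norm z \<le> t" and "1 \<le> t"
  shows "norm (poly p z) \<le> (\<Sum>i\<le>degree p. norm (coeff p i)) * t ^ degree p"
proof -
  have "norm (coeff p i * z ^ i) \<le> norm (coeff p i) * t ^ degree p" if "i \<le> degree p" for i
  proof -
    have "norm z ^ i \<le> t ^ i"
      using assms by (simp add: power_mono)
    also have "\<dots> \<le> t ^ degree p"
      using assms that by (simp add: power_increasing)
    finally show ?thesis
      by (simp add: norm_mult norm_power mult_left_mono)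
  qed
  then have "norm (\<Sum>i\<le>degree p. coeff p i * z ^ i) \<le> (\<Sum>i\<le>degree p. norm (coeff p i) * t ^ degree p)"
    by (intro sum_norm_le) auto
  then show ?thesis
    by (simp add: poly_altdef sum_distrib_right)
qed

text \<open>The quotient by \<open>y ^ degree p\<close> tends to the leading coefficient, so half
  its modulus is a lower bound far out. Phrasing "far out" as a condition on all large
  \<open>R\<close> lets it be combined with the other thresholds of the filtration.\<close>

lemma norm_poly_ge_power:
  fixes p :: "'a::real_normed_field poly"
  assumes "p \<noteq> 0"
  obtains \<kappa> where "\<kappa> > 0" and "\<forall>\<^sub>F R in at_top. \<forall>y. R \<le> norm y \<longrightarrow> \<kappa> * norm y ^ degree p \<le> norm (poly p y)"
proof
  let ?\<kappa> = "norm (lead_coeff p) / 2"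
  show pos: "?\<kappa> > 0"
    using assms by simp
  have "((\<lambda>y. norm (poly p y / y ^ degree p)) \<longlongrightarrow> norm (lead_coeff p)) at_infinity"
    by (intro tendsto_norm poly_divide_tendsto_aux)
  then have "\<forall>\<^sub>F y in at_infinity. norm (poly p y / y ^ degree p) > ?\<kappa>"
    using pos by (intro order_tendstoD(1)[where y = "norm (lead_coeff p)"]) auto
  then obtain B where B: "\<And>y. B \<le> norm y \<Longrightarrow> norm (poly p y / y ^ degree p) > ?\<kappa>"
    unfolding eventually_at_infinity by blast
  show "\<forall>\<^sub>F R in at_top. \<forall>y. R \<le> norm y \<longrightarrow> ?\<kappa> * norm y ^ degree p \<le> norm (poly p y)"
  proof (rule eventually_at_top_linorderI[of "max B 1"], intro allI impI)
    fix R :: real and y :: 'a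
    assume "max B 1 \<le> R" "R \<le> norm y"
    then have "?\<kappa> < norm (poly p y) / norm y ^ degree p" and "norm y > 0"
      using B[of y] by (auto simp: norm_divide norm_power)
    then show "?\<kappa> * norm y ^ degree p \<le> norm (poly p y)"
      by (simp add: pos_less_divide_eq less_imp_le)
  qed
qed

text \<open>Maximum modulus principle on the disc; for \<open>r = 0\<close> the circle is the center
  itself.\<close>

lemma norm_poly_center_le:
  assumes "\<And>w. norm w = r \<Longrightarrow> norm (poly p w) \<le> M" and "0 \<le> r"
  shows "norm (poly p (0::complex)) \<le> M"
proof (cases "r = 0")
  case False
  show ?thesis
  proof (rule maximum_modulus_frontier[where S = "cball 0 r" and f = "poly p"])
    show "continuous_on (closure (cball 0 r)) (poly p)"
      by (intro continuous_intros)
    show "poly p holomorphic_on interior (cball 0 r)"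
      by (intro holomorphic_intros)
  qed (use assms False in \<open>auto simp: dist_norm\<close>)
qed (use assms in auto)

text \<open>Dini's argument: the open sets where \<open>f n\<close> is below \<open>c\<close> cover
  \<open>S\<close>, and by monotonicity the largest index of a finite subcover works
  everywhere.\<close>

lemma decreasing_sequence_below_on_compact:
  fixes f :: "nat \<Rightarrow> 'a::topological_space \<Rightarrow> real"
  assumes "compact S" and cont: "\<And>n. continuous_on UNIV (f n)"
    and dec: "\<And>x. decseq (\<lambda>n. f n x)" and below: "\<And>x. x \<in> S \<Longrightarrow> \<exists>n. f n x < c"
  shows "\<exists>N. \<forall>n\<ge>N. \<forall>x\<in>S. f n x < c"
proof -
  have opn: "open {x. f n x < c}" for n
    by (intro open_Collect_less cont continuous_on_const)
  have "S \<subseteq> (\<Union>n\<in>UNIV. {x. f n x < c})"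
    using below by auto
  then obtain I where I: "finite I" "S \<subseteq> (\<Union>n\<in>I. {x. f n x < c})"
    by (rule compactE_image[OF \<open>compact S\<close> opn])
  \<comment> \<open>A point of \<open>S\<close> forces \<open>I\<close> to be nonempty, so the value
    of \<open>Max\<close> on the empty set does not matter.\<close>
  have "f n x < c" if "Max I \<le> n" "x \<in> S" for n x
  proof -
    obtain i where "i \<in> I" "f i x < c"
      using I(2) \<open>x \<in> S\<close> by auto
    moreover have "i \<le> n"
      using Max_ge[OF I(1) \<open>i \<in> I\<close>] that(1) by simp
    ultimately show ?thesis
      using decseqD[OF dec, of i n x] by simp
  qed
  then show ?thesis
    by blast
qed

text \<open>The outermost factor is split off. The induction starts at a single factor rather than
  at \<open>id\<close>, because the identity has degree 1 and maps the axis to itself, outside every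
  escape region with positive \<open>R\<close>.\<close>

lemma henon_map_induct [consumes 1, case_names factor comp]:
  assumes "henon_map H d"
    and factor: "\<And>b p \<delta>. degree p \<ge> 2 \<Longrightarrow> b * \<delta> \<noteq> 0 \<Longrightarrow> P (henon_factor b p \<delta>) (degree p)"
    and comp: "\<And>F k b p \<delta>. P F k \<Longrightarrow> degree p \<ge> 2 \<Longrightarrow> b * \<delta> \<noteq> 0 \<Longrightarrow>
      P (henon_factor b p \<delta> \<circ> F) (degree p * k)"
  shows "P H d"
proof -
  obtain m b p \<delta> where "m \<ge> 1" and hyp: "\<forall>j\<in>{1..m}. degree (p j) \<ge> 2 \<and> b j * \<delta> j \<noteq> 0"
    and H: "H = fold (\<lambda>j F. henon_factor (b j) (p j) (\<delta> j) \<circ> F) [1..<Suc m] id"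
    and d: "d = (\<Prod>j=1..m. degree (p j))"
    using assms(1) unfolding henon_map_def by blast
  have "P (fold (\<lambda>j F. henon_factor (b j) (p j) (\<delta> j) \<circ> F) [1..<Suc n] id)
      (\<Prod>j=1..n. degree (p j))" if "1 \<le> n" "n \<le> m" for n
    using that
  proof (induction n rule: nat_induct_at_least)
    case base
    then show ?case
      using factor[of "p 1" "b 1" "\<delta> 1"] hyp by simp
  next
    case (Suc n)
    have "fold f [1..<Suc (Suc n)] id = f (Suc n) (fold f [1..<Suc n] id)"
      for f :: "nat \<Rightarrow> (C2 \<Rightarrow> C2) \<Rightarrow> C2 \<Rightarrow> C2"
      by simp
    moreover have "(\<Prod>j=1..Suc n. degree (p j)) = degree (p (Suc n)) * (\<Prod>j=1..n. degree (p j))"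
      by (simp add: mult.commute)
    moreover have "degree (p (Suc n)) \<ge> 2" "b (Suc n) * \<delta> (Suc n) \<noteq> 0"
      using hyp Suc.prems by auto
    moreover have "n \<le> m"
      using Suc.prems by simp
    ultimately show ?case
      using comp[OF Suc.IH, of "p (Suc n)" "b (Suc n)" "\<delta> (Suc n)"]
      by (simp only: not_False_eq_True simp_thms)
  qed
  then show ?thesis
    using \<open>m \<ge> 1\<close> H d by blast
qed

lemma henon_map_degree_ge_2: "henon_map H d \<Longrightarrow> 2 \<le> d"
proof (induction rule: henon_map_induct)
  case (comp F k b p \<delta>)
  then have "2 * 1 \<le> degree p * k"
    by (intro mult_le_mono) auto
  then show ?case
    by simp
qed

section \<open>Growth and polynomial slices\<close>

text \<open>A factor of degree k grows at most like a constant times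
  \<open>max 1 (norm z) ^ k\<close>; under composition the additive constants combine to
  \<open>degree p * C1 + C2\<close>. This bound is what makes the majorants of the Green function
  decrease.\<close>

lemma henon_map_log_plus_le:
  assumes "henon_map H d"
  shows "\<exists>C\<ge>0. \<forall>z. log_plus (norm (H z)) \<le> d * log_plus (norm z) + C"
  using assms
proof (induction rule: henon_map_induct)
  have step: "\<exists>C\<ge>0. \<forall>z. log_plus (norm (henon_factor b p \<delta> z)) \<le> degree p * log_plus (norm z) + C"
    if "degree p \<ge> 2" for b p \<delta>
  proof -
    define S where "S = (\<Sum>i\<le>degree p. norm (coeff p i))"
    \<comment> \<open>The summand 1 gives \<open>K \<ge> 1\<close>, so that \<open>ln K\<close> is
      nonnegative and \<open>K * t ^ degree p\<close> dominates the 1 in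
      \<open>max 1\<close>.\<close>
    define K where "K = 1 + norm b + S + norm \<delta>"
    have "S \<ge> 0"
      unfolding S_def by (intro sum_nonneg) auto
    then have K: "K \<ge> 1"
      by (simp add: K_def)
    have "log_plus (norm (henon_factor b p \<delta> z)) \<le> degree p * log_plus (norm z) + ln K" for z
    proof -
      obtain x y where z: "z = (x, y)"
        by (cases z)
      define t where "t = max 1 (norm z)"
      have t: "t \<ge> 1" "norm x \<le> t" "norm y \<le> t"
        using norm_fst_le[of x y] norm_snd_le[of y x] z by (auto simp: t_def)
      have tt: "t \<le> t ^ degree p" "1 \<le> t ^ degree p"
        using t(1) that self_le_power[of t "degree p"] by auto
      have "norm (henon_factor b p \<delta> z) \<le> norm (b * y) + norm (poly p y - \<delta> * x)"
        unfolding z henon_factor_def by (simp add: norm_Pair sqrt_sum_squares_le_sum)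
      also have "\<dots> \<le> norm b * norm y + (norm (poly p y) + norm \<delta> * norm x)"
        using norm_triangle_ineq4[of "poly p y" "\<delta> * x"] by (simp add: norm_mult)
      also have "\<dots> \<le> norm b * t ^ degree p + (S * t ^ degree p + norm \<delta> * t ^ degree p)"
        using norm_poly_le_power[OF t(3,1), of p] t tt
        unfolding S_def by (intro add_mono mult_left_mono) auto
      also have "\<dots> = (norm b + S + norm \<delta>) * t ^ degree p"
        by (simp add: algebra_simps)
      also have "\<dots> \<le> K * t ^ degree p"
        using t by (intro mult_right_mono) (auto simp: K_def)
      finally have "norm (henon_factor b p \<delta> z) \<le> K * t ^ degree p" .
      moreover have "1 \<le> K * t ^ degree p"
        using mult_mono[OF K tt(2)] K by simp
      ultimately have "log_plus (norm (henon_factor b p \<delta> z)) \<le> ln (K * t ^ degree p)"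
        by (subst log_plus_eq) (auto intro!: ln_mono)
      also have "\<dots> = degree p * log_plus (norm z) + ln K"
        using K t(1) by (simp add: ln_mult ln_realpow log_plus_eq t_def)
      finally show ?thesis .
    qed
    then show ?thesis
      using K by (intro exI[of _ "ln K"]) auto
  qed
  {
    case (factor b p \<delta>)
    show ?case
      by (rule step[OF factor(1)])
  next
    case (comp F k b p \<delta>)
    obtain C1 where C1: "C1 \<ge> 0" "\<And>z. log_plus (norm (F z)) \<le> k * log_plus (norm z) + C1"
      using comp(1) by blast
    obtain C2 where C2: "C2 \<ge> 0"
      "\<And>z. log_plus (norm (henon_factor b p \<delta> z)) \<le> degree p * log_plus (norm z) + C2"
      using step[OF comp(2)] by blast
    have "log_plus (norm ((henon_factor b p \<delta> \<circ> F) z))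
        \<le> real (degree p * k) * log_plus (norm z) + (degree p * C1 + C2)" for z
      using C2(2)[of "F z"] mult_left_mono[OF C1(2)[of z], of "real (degree p)"]
      by (simp add: algebra_simps)
    then show ?case
      using C1(1) C2(1) by (intro exI[of _ "degree p * C1 + C2"]) auto
  }
qed

text \<open>A substitute for being a polynomial map: it is stable under composition, and it yields
  all that is used later, namely that iterates are polynomial along vertical lines.\<close>

definition preserves_polynomial_curves :: "(C2 \<Rightarrow> C2) \<Rightarrow> bool" where
  "preserves_polynomial_curves F \<longleftrightarrow>
     (\<forall>p q. \<exists>p' q'. \<forall>w. F (poly p w, poly q w) = (poly p' w, poly q' w))"

lemma preserves_polynomial_curves_comp:
  assumes "preserves_polynomial_curves F" "preserves_polynomial_curves G"
  shows "preserves_polynomial_curves (G \<circ> F)"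
  unfolding preserves_polynomial_curves_def
proof (intro allI)
  fix p q
  obtain p1 q1 where "\<forall>w. F (poly p w, poly q w) = (poly p1 w, poly q1 w)"
    using assms(1) unfolding preserves_polynomial_curves_def by blast
  moreover obtain p2 q2 where "\<forall>w. G (poly p1 w, poly q1 w) = (poly p2 w, poly q2 w)"
    using assms(2) unfolding preserves_polynomial_curves_def by blast
  ultimately show "\<exists>p' q'. \<forall>w. (G \<circ> F) (poly p w, poly q w) = (poly p' w, poly q' w)"
    by auto
qed

lemma preserves_polynomial_curves_funpow:
  assumes "preserves_polynomial_curves F"
  shows "preserves_polynomial_curves (F ^^ n)"
proof (induction n)
  case 0
  then show ?case
    by (auto simp: preserves_polynomial_curves_def)
qed (simp only: funpow.simps preserves_polynomial_curves_comp assms)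

lemma henon_map_preserves_polynomial_curves:
  "henon_map H d \<Longrightarrow> preserves_polynomial_curves H"
proof (induction rule: henon_map_induct)
  have step: "preserves_polynomial_curves (henon_factor b p \<delta>)" for b p \<delta>
    unfolding preserves_polynomial_curves_def
  proof (intro allI)
    fix r q :: "complex poly"
    show "\<exists>p' q'. \<forall>w. henon_factor b p \<delta> (poly r w, poly q w) = (poly p' w, poly q' w)"
      by (intro exI[of _ "smult b q"] exI[of _ "pcompose p q - smult \<delta> r"])
        (simp add: henon_factor_def poly_pcompose)
  qed
  {
    case factor
    show ?case
      by (rule step)
  next
    case comp
    then show ?case
      by (intro preserves_polynomial_curves_comp step)
  }
qed

lemma preserves_polynomial_curves_slice:
  assumes "preserves_polynomial_curves F"
  obtains p q where "\<And>w. F (x, w) = (poly p w, poly q w)"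
  using assms[unfolded preserves_polynomial_curves_def, rule_format, of "[:x:]" "[:0, 1:]"] by auto

section \<open>The filtration\<close>

text \<open>The region V+ of the usual Henon filtration. The aperture \<alpha> replaces 1 because
  the first coordinate \<open>b * y\<close> of the image may exceed \<open>y\<close> in modulus;
  \<alpha> will satisfy \<open>\<alpha> * norm b \<le> 1\<close>.\<close>

definition escape_region :: "real \<Rightarrow> real \<Rightarrow> C2 set" where
  "escape_region \<alpha> R = {z. R \<le> norm (snd z) \<and> \<alpha> * norm (fst z) \<le> norm (snd z)}"

text \<open>The last clause controls points that have not escaped yet. It has the same bound \<rho>
  before and after \<open>F\<close>, which makes it stable under iteration.\<close>

definition respects_filtration :: "real \<Rightarrow> real \<Rightarrow> (C2 \<Rightarrow> C2) \<Rightarrow> bool" where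
  "respects_filtration \<alpha> R F \<longleftrightarrow>
     (\<forall>z\<in>escape_region \<alpha> R. F z \<in> escape_region \<alpha> R \<and> norm (snd z) \<le> norm (snd (F z))) \<and>
     (\<forall>\<rho> z. R \<le> \<alpha> * \<rho> \<longrightarrow> norm (fst z) \<le> \<rho> \<longrightarrow> F z \<notin> escape_region \<alpha> R \<longrightarrow> norm (fst (F z)) \<le> \<rho>)"

definition expands_log :: "real \<Rightarrow> real \<Rightarrow> nat \<Rightarrow> (C2 \<Rightarrow> C2) \<Rightarrow> bool" where
  "expands_log \<alpha> R k F \<longleftrightarrow>
     (\<exists>C\<ge>0. \<forall>z\<in>escape_region \<alpha> R. k * ln (norm (snd z)) - C \<le> ln (norm (snd (F z))))"

text \<open>For positive \<open>R\<close> the axis misses the escape region, so the condition is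
  about its image; that image has to meet the region arbitrarily far out.\<close>

definition axis_reaches_escape :: "real \<Rightarrow> real \<Rightarrow> (C2 \<Rightarrow> C2) \<Rightarrow> bool" where
  "axis_reaches_escape \<alpha> R F \<longleftrightarrow>
     (\<forall>B. \<exists>x. F (x, 0) \<in> escape_region \<alpha> R \<and> B \<le> norm (snd (F (x, 0))))"

lemma respects_filtrationD:
  assumes "respects_filtration \<alpha> R F" and "z \<in> escape_region \<alpha> R"
  shows "F z \<in> escape_region \<alpha> R" and "norm (snd z) \<le> norm (snd (F z))"
  using assms by (auto simp: respects_filtration_def)

lemma respects_filtration_fst_le:
  assumes "respects_filtration \<alpha> R F" "R \<le> \<alpha> * \<rho>" "norm (fst z) \<le> \<rho>" "F z \<notin> escape_region \<alpha> R"
  shows "norm (fst (F z)) \<le> \<rho>"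
  using assms unfolding respects_filtration_def by blast

text \<open>If the final image lies outside the escape region, then by forward invariance so does
  the intermediate one, and the bound \<rho> passes through both maps.\<close>

lemma respects_filtration_comp:
  assumes F: "respects_filtration \<alpha> R F" and G: "respects_filtration \<alpha> R G"
  shows "respects_filtration \<alpha> R (G \<circ> F)"
  unfolding respects_filtration_def
proof (intro conjI ballI allI impI)
  fix z assume z: "z \<in> escape_region \<alpha> R"
  show "(G \<circ> F) z \<in> escape_region \<alpha> R"
    using respects_filtrationD(1)[OF G respects_filtrationD(1)[OF F z]] by simp
  show "norm (snd z) \<le> norm (snd ((G \<circ> F) z))"
    using respects_filtrationD(2)[OF F z]
      respects_filtrationD(2)[OF G respects_filtrationD(1)[OF F z]] by simp
next
  fix \<rho> z
  assume \<rho>: "R \<le> \<alpha> * \<rho>" "norm (fst z) \<le> \<rho>" and "(G \<circ> F) z \<notin> escape_region \<alpha> R"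
  then have GF: "G (F z) \<notin> escape_region \<alpha> R"
    by simp
  then have "F z \<notin> escape_region \<alpha> R"
    using respects_filtrationD(1)[OF G] by blast
  then have "norm (fst (F z)) \<le> \<rho>"
    by (rule respects_filtration_fst_le[OF F \<rho>])
  then show "norm (fst ((G \<circ> F) z)) \<le> \<rho>"
    using respects_filtration_fst_le[OF G \<rho>(1) _ GF] by simp
qed

lemma respects_filtration_funpow:
  assumes "respects_filtration \<alpha> R F"
  shows "respects_filtration \<alpha> R (F ^^ n)"
proof (induction n)
  case 0
  then show ?case
    by (auto simp: respects_filtration_def)
qed (simp only: funpow.simps respects_filtration_comp assms)

lemma expands_log_comp:
  assumes "expands_log \<alpha> R k F" "expands_log \<alpha> R l G" "respects_filtration \<alpha> R F"
  shows "expands_log \<alpha> R (l * k) (G \<circ> F)"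
proof -
  obtain C1 where C1: "C1 \<ge> 0"
    "\<And>z. z \<in> escape_region \<alpha> R \<Longrightarrow> k * ln (norm (snd z)) - C1 \<le> ln (norm (snd (F z)))"
    using assms(1) unfolding expands_log_def by blast
  obtain C2 where C2: "C2 \<ge> 0"
    "\<And>z. z \<in> escape_region \<alpha> R \<Longrightarrow> l * ln (norm (snd z)) - C2 \<le> ln (norm (snd (G z)))"
    using assms(2) unfolding expands_log_def by blast
  have "real (l * k) * ln (norm (snd z)) - (l * C1 + C2) \<le> ln (norm (snd ((G \<circ> F) z)))"
    if "z \<in> escape_region \<alpha> R" for z
  proof -
    have "F z \<in> escape_region \<alpha> R"
      by (rule respects_filtrationD(1)[OF assms(3) that])
    from C2(2)[OF this] mult_left_mono[OF C1(2)[OF that], of "real l"] show ?thesis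
      by (simp add: algebra_simps)
  qed
  then show ?thesis
    unfolding expands_log_def using C1(1) C2(1) by (intro exI[of _ "l * C1 + C2"]) auto
qed

lemma axis_reaches_escape_comp:
  assumes "axis_reaches_escape \<alpha> R F" and G: "respects_filtration \<alpha> R G"
  shows "axis_reaches_escape \<alpha> R (G \<circ> F)"
  unfolding axis_reaches_escape_def
proof
  fix B
  obtain x where x: "F (x, 0) \<in> escape_region \<alpha> R" "B \<le> norm (snd (F (x, 0)))"
    using assms(1) unfolding axis_reaches_escape_def by blast
  then show "\<exists>x. (G \<circ> F) (x, 0) \<in> escape_region \<alpha> R \<and> B \<le> norm (snd ((G \<circ> F) (x, 0)))"
    using respects_filtrationD[OF G x(1)] by (intro exI[of _ x]) auto
qed

text \<open>In the escape region \<open>poly p y\<close> dominates \<open>\<delta> * x\<close>: the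
  thresholds for \<open>R\<close> let half of the lower bound
  \<open>\<kappa> * norm y ^ degree p\<close> survive the subtraction.\<close>

lemma henon_factor_filtration_pointwise:
  assumes deg: "degree p \<ge> 2" and \<delta>: "\<delta> \<noteq> 0" and \<alpha>: "\<alpha> > 0" "\<alpha> * norm b \<le> 1"
    and \<kappa>: "\<kappa> > 0" "\<forall>y. R \<le> norm y \<longrightarrow> \<kappa> * norm y ^ degree p \<le> norm (poly p y)"
    and R: "1 \<le> R" "2 / \<kappa> \<le> R" "2 * norm \<delta> / (\<alpha> * \<kappa>) \<le> R"
  shows "respects_filtration \<alpha> R (henon_factor b p \<delta>)"
    and "expands_log \<alpha> R (degree p) (henon_factor b p \<delta>)"
    and "axis_reaches_escape \<alpha> R (henon_factor b p \<delta>)"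
proof -
  let ?F = "henon_factor b p \<delta>"
  \<comment> \<open>Both \<open>norm y\<close> and \<open>norm \<delta> * norm x\<close> are at most
    \<open>\<kappa> / 2 * norm y ^ 2\<close>, by the second and the third threshold for
    \<open>R\<close>; degree at least 2 then gives the two bounds.\<close>
  have growth: "\<kappa> / 2 * norm y ^ degree p \<le> norm (poly p y - \<delta> * x) \<and>
      norm y \<le> norm (poly p y - \<delta> * x)"
    if y: "R \<le> norm y" "\<alpha> * norm x \<le> norm y" for x y
  proof -
    have y1: "1 \<le> norm y"
      using R y by simp
    have "norm y * norm y \<le> norm y ^ degree p"
      using power_increasing[OF deg y1] by (simp add: power2_eq_square)
    then have sq: "\<kappa> / 2 * norm y * norm y \<le> \<kappa> / 2 * norm y ^ degree p"
      using \<kappa>(1) by (simp add: mult.assoc mult_left_mono)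
    have "2 \<le> \<kappa> * R"
      using R(2) \<kappa>(1) by (simp add: pos_divide_le_eq mult.commute)
    also have "\<dots> \<le> \<kappa> * norm y"
      using y(1) \<kappa>(1) by simp
    finally have "1 * norm y \<le> \<kappa> / 2 * norm y * norm y"
      by (intro mult_right_mono) auto
    moreover have "norm \<delta> * norm x \<le> \<kappa> / 2 * norm y * norm y"
    proof -
      have "2 * norm \<delta> / (\<alpha> * \<kappa>) \<le> norm y"
        using R(3) y(1) by simp
      then have "norm \<delta> \<le> \<kappa> / 2 * norm y * \<alpha>"
        using \<kappa>(1) \<alpha>(1) by (simp add: pos_divide_le_eq field_simps)
      then have "norm \<delta> * norm x \<le> \<kappa> / 2 * norm y * \<alpha> * norm x"
        by (intro mult_right_mono) auto
      also have "\<dots> = \<kappa> / 2 * norm y * (\<alpha> * norm x)"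
        by simp
      also have "\<dots> \<le> \<kappa> / 2 * norm y * norm y"
        using y(2) \<kappa>(1) by (intro mult_left_mono) auto
      finally show ?thesis .
    qed
    moreover have "\<kappa> * norm y ^ degree p - norm \<delta> * norm x \<le> norm (poly p y - \<delta> * x)"
      using \<kappa>(2) y(1) norm_triangle_ineq2[of "poly p y" "\<delta> * x"] by (auto simp: norm_mult)
    ultimately show ?thesis
      using sq by auto
  qed
  have inv: "?F z \<in> escape_region \<alpha> R \<and> norm (snd z) \<le> norm (snd (?F z))"
    if z: "z \<in> escape_region \<alpha> R" for z
  proof -
    obtain x y where xy: "z = (x, y)"
      by (cases z)
    have y: "R \<le> norm y" "\<alpha> * norm x \<le> norm y"
      using z by (auto simp: escape_region_def xy)
    have "\<alpha> * norm (b * y) \<le> norm y"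
      using mult_right_mono[OF \<alpha>(2), of "norm y"] by (simp add: norm_mult mult.assoc)
    then show ?thesis
      using growth[OF y] y by (auto simp: escape_region_def xy henon_factor_def)
  qed
  \<comment> \<open>By invariance \<open>z\<close> itself is outside the region, so
    \<open>norm y\<close> is at most \<open>\<alpha> * \<rho>\<close>, and
    \<open>\<alpha> * norm b \<le> 1\<close> controls the new first coordinate.\<close>
  have "norm (fst (?F z)) \<le> \<rho>"
    if "R \<le> \<alpha> * \<rho>" "norm (fst z) \<le> \<rho>" "?F z \<notin> escape_region \<alpha> R" for \<rho> z
  proof -
    obtain x y where xy: "z = (x, y)"
      by (cases z)
    have "z \<notin> escape_region \<alpha> R"
      using inv that(3) by blast
    then have "norm y < R \<or> norm y < \<alpha> * norm x"
      by (auto simp: escape_region_def xy)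
    moreover have "\<alpha> * norm x \<le> \<alpha> * \<rho>"
      using that(2) \<alpha>(1) xy by simp
    ultimately have "norm y \<le> \<alpha> * \<rho>"
      using that(1) by linarith
    then have "norm (b * y) \<le> norm b * (\<alpha> * \<rho>)"
      by (simp add: norm_mult mult_left_mono)
    also have "\<dots> = (\<alpha> * norm b) * \<rho>"
      by simp
    also have "\<dots> \<le> 1 * \<rho>"
      using \<alpha> that(2) order_trans[OF norm_ge_zero that(2)] by (intro mult_right_mono) auto
    finally show ?thesis
      by (simp add: xy henon_factor_def)
  qed
  then show "respects_filtration \<alpha> R ?F"
    using inv unfolding respects_filtration_def by blast
  \<comment> \<open>The absolute value is taken because \<open>expands_log\<close> asks for a
    nonnegative constant, while \<open>ln (\<kappa> / 2)\<close> may have either sign.\<close>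
  have "degree p * ln (norm (snd z)) - \<bar>ln (\<kappa> / 2)\<bar> \<le> ln (norm (snd (?F z)))"
    if z: "z \<in> escape_region \<alpha> R" for z
  proof -
    obtain x y where xy: "z = (x, y)"
      by (cases z)
    have y: "R \<le> norm y" "\<alpha> * norm x \<le> norm y"
      using z by (auto simp: escape_region_def xy)
    then have y0: "0 < norm y"
      using R by linarith
    have "ln (\<kappa> / 2 * norm y ^ degree p) \<le> ln (norm (poly p y - \<delta> * x))"
      using growth[OF y] y0 \<kappa>(1) by (intro ln_mono) auto
    moreover have "ln (\<kappa> / 2 * norm y ^ degree p) = ln (\<kappa> / 2) + degree p * ln (norm y)"
      using y0 \<kappa>(1) by (subst ln_mult) (auto simp: ln_realpow)
    ultimately show ?thesis
      by (simp add: xy henon_factor_def)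
  qed
  then show "expands_log \<alpha> R (degree p) ?F"
    unfolding expands_log_def by (intro exI[of _ "\<bar>ln (\<kappa> / 2)\<bar>"]) auto
  show "axis_reaches_escape \<alpha> R ?F"
    unfolding axis_reaches_escape_def
  proof
    fix B
    \<comment> \<open>The factor sends (x, 0) to (0, \<open>poly p 0 - \<delta> * x\<close>).
      Solving for the second coordinate to equal \<open>T\<close> gives the witness.\<close>
    define T :: complex where "T = of_real (max B R)"
    have "?F ((poly p 0 - T) / \<delta>, 0) = (0, T)"
      using \<delta> by (simp add: henon_factor_def)
    moreover have "norm T = max B R" "0 \<le> max B R"
      using R(1) by (auto simp: T_def)
    ultimately show "\<exists>x. ?F (x, 0) \<in> escape_region \<alpha> R \<and> B \<le> norm (snd (?F (x, 0)))"
      by (intro exI[of _ "(poly p 0 - T) / \<delta>"]) (simp add: escape_region_def)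
  qed
qed

text \<open>\<alpha> comes first, since the threshold
  \<open>2 * norm \<delta> / (\<alpha> * \<kappa>)\<close> for \<open>R\<close> depends on it.
  Stated with eventual quantifiers, the result lets finitely many factors share one \<alpha> and one
  \<open>R\<close>.\<close>

lemma henon_factor_filtration:
  assumes "degree p \<ge> 2" and "b * \<delta> \<noteq> 0"
  shows "\<forall>\<^sub>F \<alpha> in at_right 0. \<forall>\<^sub>F R in at_top. respects_filtration \<alpha> R (henon_factor b p \<delta>) \<and>
    expands_log \<alpha> R (degree p) (henon_factor b p \<delta>) \<and> axis_reaches_escape \<alpha> R (henon_factor b p \<delta>)"
proof -
  have "p \<noteq> 0"
    using assms(1) by auto
  then obtain \<kappa> where \<kappa>: "\<kappa> > 0"
    "\<forall>\<^sub>F R in at_top. \<forall>y. R \<le> norm y \<longrightarrow> \<kappa> * norm y ^ degree p \<le> norm (poly p y)"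
    by (rule norm_poly_ge_power)
  have "((\<lambda>\<alpha>. \<alpha> * norm b) \<longlongrightarrow> 0 * norm b) (at_right 0)"
    by (intro tendsto_intros)
  then have "\<forall>\<^sub>F \<alpha> in at_right 0. \<alpha> * norm b < 1"
    by (rule order_tendstoD) simp
  moreover have "\<forall>\<^sub>F \<alpha> in at_right (0::real). \<alpha> > 0"
    by (rule eventually_at_right_less)
  ultimately show ?thesis
  proof eventually_elim
    case (elim \<alpha>)
    show ?case
      using \<kappa>(2) eventually_ge_at_top[of 1] eventually_ge_at_top[of "2 / \<kappa>"]
        eventually_ge_at_top[of "2 * norm \<delta> / (\<alpha> * \<kappa>)"]
    proof eventually_elim
      case (elim R)
      then show ?case
        using henon_factor_filtration_pointwise[of p \<delta> \<alpha> b \<kappa> R] assms \<open>\<alpha> > 0\<close> \<open>\<alpha> * norm b < 1\<close> \<kappa>(1)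
        by simp
    qed
  qed
qed

lemma henon_map_filtration:
  assumes "henon_map H d"
  shows "\<forall>\<^sub>F \<alpha> in at_right 0. \<forall>\<^sub>F R in at_top.
    respects_filtration \<alpha> R H \<and> expands_log \<alpha> R d H \<and> axis_reaches_escape \<alpha> R H"
  using assms
proof (induction rule: henon_map_induct)
  case (factor b p \<delta>)
  then show ?case
    by (rule henon_factor_filtration)
next
  case (comp F k b p \<delta>)
  show ?case
    using comp(1) henon_factor_filtration[OF comp(2,3)]
  proof eventually_elim
    case (elim \<alpha>)
    then show ?case
      by eventually_elim (blast intro: respects_filtration_comp expands_log_comp axis_reaches_escape_comp)
  qed
qed

section \<open>Orbits: escape of a point on the axis, and points of vertical lines with bounded
  iterates\<close>

lemma expands_log_funpow:
  assumes "respects_filtration \<alpha> R F" and "expands_log \<alpha> R k F" and "2 \<le> k"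
  obtains C where "\<And>n z. z \<in> escape_region \<alpha> R \<Longrightarrow>
    real k ^ n * (ln (norm (snd z)) - C) \<le> ln (norm (snd ((F ^^ n) z)))"
proof -
  obtain C where C: "C \<ge> 0"
    "\<And>z. z \<in> escape_region \<alpha> R \<Longrightarrow> k * ln (norm (snd z)) - C \<le> ln (norm (snd (F z)))"
    using assms(2) unfolding expands_log_def by blast
  \<comment> \<open>The additional \<open>+ C\<close> makes the induction close: each step loses
    \<open>C\<close> but multiplies the surplus by \<open>k\<close>, and
    \<open>k * C - C \<ge> C\<close> as \<open>k \<ge> 2\<close>.\<close>
  have ind: "real k ^ n * (ln (norm (snd z)) - C) + C \<le> ln (norm (snd ((F ^^ n) z)))"
    if z: "z \<in> escape_region \<alpha> R" for n z
  proof (induction n)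
    case (Suc n)
    have "(F ^^ n) z \<in> escape_region \<alpha> R"
      by (rule respects_filtrationD(1)[OF respects_filtration_funpow[OF assms(1)] z])
    from C(2)[OF this] have "k * ln (norm (snd ((F ^^ n) z))) - C \<le> ln (norm (snd ((F ^^ Suc n) z)))"
      by simp
    moreover have "real k * (real k ^ n * (ln (norm (snd z)) - C) + C) \<le> k * ln (norm (snd ((F ^^ n) z)))"
      using Suc by (intro mult_left_mono) auto
    moreover have "2 * C \<le> real k * C"
      using assms(3) C(1) by (intro mult_right_mono) auto
    ultimately show ?case
      by (simp add: algebra_simps)
  qed simp
  show thesis
  proof (rule that[of C])
    fix n z assume "z \<in> escape_region \<alpha> R"
    then show "real k ^ n * (ln (norm (snd z)) - C) \<le> ln (norm (snd ((F ^^ n) z)))"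
      using ind[of z n] C(1) by linarith
  qed
qed

lemma axis_orbit_escapes:
  assumes "respects_filtration \<alpha> R F" "expands_log \<alpha> R k F" "axis_reaches_escape \<alpha> R F" "2 \<le> k"
  obtains x where "\<And>n. c * real k ^ Suc n \<le> log_plus (norm ((F ^^ Suc n) (x, 0)))"
proof -
  obtain C where C: "\<And>n z. z \<in> escape_region \<alpha> R \<Longrightarrow>
      real k ^ n * (ln (norm (snd z)) - C) \<le> ln (norm (snd ((F ^^ n) z)))"
    using expands_log_funpow[OF assms(1,2,4)] by blast
  \<comment> \<open>The first iterate is placed so far out that the other \<open>n\<close> iterates
    give \<open>k ^ n * (k * c)\<close>, that is, \<open>c * k ^ Suc n\<close>. The shift by one
    occurs because (x, 0) itself need not lie in the escape region.\<close>
  obtain x where x: "F (x, 0) \<in> escape_region \<alpha> R" "exp (k * c + C) \<le> norm (snd (F (x, 0)))"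
    using assms(3) unfolding axis_reaches_escape_def by blast
  have "c * real k ^ Suc n \<le> log_plus (norm ((F ^^ Suc n) (x, 0)))" for n
  proof -
    have "exp (k * c + C) > 0"
      by simp
    with x(2) have "k * c + C \<le> ln (norm (snd (F (x, 0))))"
      using ln_mono[of "exp (k * c + C)"] by simp
    then have "real k ^ n * (k * c) \<le> real k ^ n * (ln (norm (snd (F (x, 0)))) - C)"
      by (intro mult_left_mono) auto
    also have "\<dots> \<le> ln (norm (snd ((F ^^ n) (F (x, 0)))))"
      by (rule C[OF x(1)])
    also have "\<dots> \<le> log_plus (norm (snd ((F ^^ n) (F (x, 0)))))"
      by (simp add: log_plus_def)
    also have "\<dots> \<le> log_plus (norm ((F ^^ n) (F (x, 0))))"
      by (intro log_plus_mono) (auto intro: norm_snd_le[of "snd z" "fst z" for z, simplified])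
    finally show ?thesis
      by (simp add: funpow_swap1 mult_ac)
  qed
  then show thesis
    by (rule that)
qed

text \<open>The second coordinate of the n-th iterate on the line over \<open>x\<close> is a
  polynomial with a root. At a root the iterate is outside the escape region, so its first
  coordinate is at most \<rho>, which depends on \<open>x\<close> but not on
  \<open>n\<close>.\<close>

lemma slice_contains_bounded_orbits:
  assumes "respects_filtration \<alpha> R F" "preserves_polynomial_curves F" "\<alpha> > 0" "R > 0"
  obtains M where "\<And>n. \<exists>w. norm ((F ^^ n) (x, w)) \<le> M"
proof -
  define \<rho> where "\<rho> = max (norm x) (R / \<alpha>)"
  have \<rho>: "norm x \<le> \<rho>" "R \<le> \<alpha> * \<rho>"
    using assms(3) by (auto simp: \<rho>_def max_def field_simps)
  have "\<exists>w. norm ((F ^^ n) (x, w)) \<le> \<rho>" for n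
  proof -
    have resp: "respects_filtration \<alpha> R (F ^^ n)"
      by (rule respects_filtration_funpow[OF assms(1)])
    obtain p q where pq: "\<And>w. (F ^^ n) (x, w) = (poly p w, poly q w)"
      using preserves_polynomial_curves_slice[OF preserves_polynomial_curves_funpow[OF assms(2)]]
      by blast
    \<comment> \<open>This excludes nonzero constants, in the form in which the fundamental theorem
      of algebra needs it. A constant \<open>q\<close> is impossible because the second coordinate
      does not shrink along escaping orbits, which start at arbitrarily large
      \<open>w\<close>.\<close>
    have "\<nexists>a l. a \<noteq> 0 \<and> l = 0 \<and> q = pCons a l"
    proof
      assume "\<exists>a l. a \<noteq> 0 \<and> l = 0 \<and> q = pCons a l"
      then have const: "poly q w = poly q 0" for w
        by auto
      define w :: complex where "w = of_real (max R (max (\<alpha> * norm x) (norm (poly q 0) + 1)))"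
      have w: "R \<le> norm w" "\<alpha> * norm x \<le> norm w" "norm (poly q 0) < norm w"
        unfolding w_def norm_of_real by linarith+
      then have "(x, w) \<in> escape_region \<alpha> R"
        by (simp add: escape_region_def)
      then have "norm w \<le> norm (poly q w)"
        using respects_filtrationD(2)[OF resp] pq[of w] by fastforce
      then show False
        using w(3) const[of w] by simp
    qed
    then obtain w where w: "poly q w = 0"
      using fundamental_theorem_of_algebra_alt by blast
    have "(F ^^ n) (x, w) \<notin> escape_region \<alpha> R"
      using assms(4) by (simp add: pq w escape_region_def)
    then have "norm (fst ((F ^^ n) (x, w))) \<le> \<rho>"
      using respects_filtration_fst_le[OF resp \<rho>(2)] \<rho>(1) by simp
    then show ?thesis
      by (intro exI[of _ w]) (simp add: pq w norm_Pair)
  qed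
  then show thesis
    by (rule that)
qed

section \<open>The Green function\<close>

definition green_majorant :: "(C2 \<Rightarrow> C2) \<Rightarrow> nat \<Rightarrow> real \<Rightarrow> nat \<Rightarrow> C2 \<Rightarrow> real" where
  "green_majorant H d C n z = (log_plus (norm ((H ^^ n) z)) + C) / real d ^ n"

lemma inverse_power_tendsto_0:
  assumes "2 \<le> d"
  shows "(\<lambda>n. a / real d ^ n) \<longlonglongrightarrow> 0"
  using assms by real_asymp

context
  fixes H :: "C2 \<Rightarrow> C2" and d :: nat and C :: real
  assumes d: "2 \<le> d" and C: "0 \<le> C"
    and bound: "\<And>z. log_plus (norm (H z)) \<le> d * log_plus (norm z) + C"
begin

text \<open>The growth bound yields a second \<open>C\<close>, and \<open>2 * C \<le> d * C\<close>
  absorbs it.\<close>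

lemma green_majorant_decseq: "decseq (\<lambda>n. green_majorant H d C n z)"
proof (rule decseq_SucI)
  fix n
  have "log_plus (norm ((H ^^ Suc n) z)) + C \<le> d * log_plus (norm ((H ^^ n) z)) + 2 * C"
    using bound[of "(H ^^ n) z"] by simp
  also have "\<dots> \<le> d * (log_plus (norm ((H ^^ n) z)) + C)"
    using mult_right_mono[of 2 "real d" C] d C by (simp add: algebra_simps)
  finally have "green_majorant H d C (Suc n) z
      \<le> d * (log_plus (norm ((H ^^ n) z)) + C) / real d ^ Suc n"
    unfolding green_majorant_def by (intro divide_right_mono) auto
  then show "green_majorant H d C (Suc n) z \<le> green_majorant H d C n z"
    using d by (simp add: green_majorant_def)
qed

text \<open>Decreasing and bounded below by 0, the majorants converge, and \<open>C / d ^ n\<close>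
  vanishes in the limit. Hence the \<open>lim\<close> in \<open>green_plus\<close> is a genuine
  limit.\<close>

lemma green_majorant_tendsto: "(\<lambda>n. green_majorant H d C n z) \<longlonglongrightarrow> green_plus H d z"
proof -
  have "0 \<le> green_majorant H d C n z" for n
    by (simp add: green_majorant_def log_plus_nonneg C)
  then obtain L where L: "(\<lambda>n. green_majorant H d C n z) \<longlonglongrightarrow> L"
    using decseq_convergent[OF green_majorant_decseq] by metis
  from tendsto_diff[OF this inverse_power_tendsto_0[OF d, of C]]
  have "(\<lambda>n. 1 / real d ^ n * log_plus (norm ((H ^^ n) z))) \<longlonglongrightarrow> L"
    by (simp add: green_majorant_def add_divide_distrib)
  then have "green_plus H d z = L"
    unfolding green_plus_def by (rule limI)
  with L show ?thesis
    by simp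
qed

lemma green_plus_le_majorant: "green_plus H d z \<le> green_majorant H d C n z"
  by (rule decseq_ge[OF green_majorant_decseq green_majorant_tendsto])

lemma green_plus_tendsto: "(\<lambda>n. log_plus (norm ((H ^^ n) z)) / real d ^ n) \<longlonglongrightarrow> green_plus H d z"
  using tendsto_diff[OF green_majorant_tendsto inverse_power_tendsto_0[OF d, of C]]
  by (simp add: green_majorant_def add_divide_distrib)

text \<open>A sub-mean-value property of the Green function on vertical discs, obtained from the
  maximum principle for the iterates.\<close>

lemma green_plus_center_le:
  assumes curves: "preserves_polynomial_curves H" and "0 \<le> r"
    and circle: "\<And>w. norm w = r \<Longrightarrow> green_plus H d (x, w) < c"
  shows "green_plus H d (x, 0) \<le> c"
proof -
  note slice = preserves_polynomial_curves_slice[OF preserves_polynomial_curves_funpow[OF curves]]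
  have "\<exists>N. \<forall>n\<ge>N. \<forall>w\<in>sphere 0 r. green_majorant H d C n (x, w) < c"
  proof (rule decreasing_sequence_below_on_compact)
    fix n
    obtain p q where "\<And>w. (H ^^ n) (x, w) = (poly p w, poly q w)"
      using slice[of n x] by blast
    then show "continuous_on UNIV (\<lambda>w. green_majorant H d C n (x, w))"
      unfolding green_majorant_def using d
      by (simp, intro continuous_intros continuous_on_log_plus_norm) auto
  next
    fix w :: complex assume "w \<in> sphere 0 r"
    then have "green_plus H d (x, w) < c"
      using circle by simp
    then show "\<exists>n. green_majorant H d C n (x, w) < c"
      using eventually_happens'[OF sequentially_bot order_tendstoD(2)[OF green_majorant_tendsto]]
      by blast
  qed (auto intro: green_majorant_decseq)
  then obtain N where "\<forall>n\<ge>N. \<forall>w\<in>sphere 0 r. green_majorant H d C n (x, w) < c" ..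
  then have N: "green_majorant H d C n (x, w) < c" if "N \<le> n" "norm w = r" for n w
    using that by simp
  \<comment> \<open>Each coordinate is bounded at the center separately, which costs a factor 2 in
    the norm; its logarithm is harmless after division by \<open>d ^ n\<close>.\<close>
  have "green_plus H d (x, 0) \<le> c + (ln 2 + C) / real d ^ n" if "N \<le> n" for n
  proof -
    obtain p q where pq: "\<And>w. (H ^^ n) (x, w) = (poly p w, poly q w)"
      using slice[of n x] by blast
    define M where "M = exp (c * real d ^ n)"
    have "norm ((H ^^ n) (x, w)) \<le> M" if "norm w = r" for w
    proof -
      have "log_plus (norm ((H ^^ n) (x, w))) \<le> c * real d ^ n"
        using N[OF \<open>N \<le> n\<close> that] d C by (simp add: green_majorant_def field_simps)
      then show ?thesis
        using le_exp_log_plus[of "norm ((H ^^ n) (x, w))"] unfolding M_def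
        by (meson exp_le_cancel_iff norm_ge_zero order_trans)
    qed
    then have M: "norm (poly p w) \<le> M" "norm (poly q w) \<le> M" if "norm w = r" for w
      using that norm_fst_le[of "poly p w" "poly q w"] norm_snd_le[of "poly q w" "poly p w"]
      by (auto simp: pq intro: order_trans)
    have "norm (poly p 0) \<le> M" "norm (poly q 0) \<le> M"
      by (rule norm_poly_center_le[OF _ \<open>0 \<le> r\<close>], rule M, assumption)+
    then have "norm ((H ^^ n) (x, 0)) \<le> 2 * M"
      unfolding pq norm_Pair using sqrt_sum_squares_le_sum[of "norm (poly p 0)" "norm (poly q 0)"]
      by simp
    \<comment> \<open>Needed to pass from \<open>log_plus\<close> to \<open>ln\<close>. The sign of
      \<open>c\<close> comes from a point of the circle, where a nonnegative majorant is below
      \<open>c\<close>.\<close>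
    moreover have "1 \<le> M"
    proof -
      have "green_majorant H d C n (x, of_real r) < c"
        using N[OF that] \<open>0 \<le> r\<close> by simp
      moreover have "0 \<le> green_majorant H d C n (x, of_real r)"
        by (simp add: green_majorant_def log_plus_nonneg C)
      ultimately show ?thesis
        by (simp add: M_def)
    qed
    ultimately have "log_plus (norm ((H ^^ n) (x, 0))) \<le> ln (2 * M)"
      by (subst log_plus_eq) (auto intro!: ln_mono)
    also have "\<dots> = ln 2 + c * real d ^ n"
      by (subst ln_mult) (auto simp: M_def)
    finally have "green_majorant H d C n (x, 0) \<le> (ln 2 + c * real d ^ n + C) / real d ^ n"
      unfolding green_majorant_def by (intro divide_right_mono add_right_mono) auto
    also have "\<dots> = c + (ln 2 + C) / real d ^ n"
      using d by (simp add: add_divide_distrib)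
    finally have "green_majorant H d C n (x, 0) \<le> c + (ln 2 + C) / real d ^ n" .
    then show ?thesis
      using green_plus_le_majorant[of "(x, 0)" n] by linarith
  qed
  moreover have "(\<lambda>n. c + (ln 2 + C) / real d ^ n) \<longlonglongrightarrow> c + 0"
    by (intro tendsto_add tendsto_const inverse_power_tendsto_0[OF d])
  ultimately have "green_plus H d (x, 0) \<le> c + 0"
    by (intro LIMSEQ_le_const) auto
  then show ?thesis
    by simp
qed

text \<open>The point \<open>w\<close> may vary with \<open>n\<close>: one sufficiently large
  \<open>n\<close> is enough, because each majorant bounds the Green function from above.\<close>

lemma slice_meets_sublevel:
  assumes "\<And>n. \<exists>w. norm ((H ^^ n) (x, w)) \<le> M" and "0 < c"
  shows "\<exists>w. green_plus H d (x, w) < c"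
proof -
  obtain n where n: "(log_plus M + C) / real d ^ n < c"
    using order_tendstoD(2)[OF inverse_power_tendsto_0[OF d, of "log_plus M + C"] assms(2)]
    by (auto simp: eventually_sequentially)
  obtain w where "norm ((H ^^ n) (x, w)) \<le> M"
    using assms(1) by blast
  then have "green_majorant H d C n (x, w) \<le> (log_plus M + C) / real d ^ n"
    unfolding green_majorant_def by (intro divide_right_mono add_right_mono log_plus_mono) auto
  then show ?thesis
    using n green_plus_le_majorant[of "(x, w)" n] by (intro exI[of _ w]) linarith
qed

end

section \<open>Contradictory bounds for the Green function at a point of the axis\<close>

theorem proposition4p3:
  fixes H :: "C2 \<Rightarrow> C2" and d :: nat and c :: real
  assumes "henon_map H d"
    and "c > 0"
  shows "\<not> reinhardt {z. green_plus H d z < c}"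
proof
  assume rein: "reinhardt {z. green_plus H d z < c}"
  note d = henon_map_degree_ge_2[OF assms(1)]
  note curves = henon_map_preserves_polynomial_curves[OF assms(1)]
  obtain C where C: "0 \<le> C" "\<And>z. log_plus (norm (H z)) \<le> d * log_plus (norm z) + C"
    using henon_map_log_plus_le[OF assms(1)] by blast
  have "\<forall>\<^sub>F \<alpha> in at_right (0::real). 0 < \<alpha> \<and> (\<forall>\<^sub>F R in at_top.
      respects_filtration \<alpha> R H \<and> expands_log \<alpha> R d H \<and> axis_reaches_escape \<alpha> R H)"
    by (intro eventually_conj eventually_at_right_less henon_map_filtration[OF assms(1)])
  then obtain \<alpha> where \<alpha>: "0 < \<alpha>" "\<forall>\<^sub>F R in at_top.
      respects_filtration \<alpha> R H \<and> expands_log \<alpha> R d H \<and> axis_reaches_escape \<alpha> R H"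
    using eventually_happens'[OF trivial_limit_at_right_real] by blast
  obtain R where R: "0 < R" "respects_filtration \<alpha> R H" "expands_log \<alpha> R d H"
      "axis_reaches_escape \<alpha> R H"
    using eventually_happens'[OF trivial_limit_at_top_linorder
        eventually_conj[OF \<alpha>(2) eventually_gt_at_top[of 0]]] by blast
  \<comment> \<open>Any constant larger than \<open>c\<close> in place of \<open>c + 1\<close> would
    contradict the upper bound \<open>c\<close> obtained below.\<close>
  obtain x where x: "\<And>n. (c + 1) * real d ^ Suc n \<le> log_plus (norm ((H ^^ Suc n) (x, 0)))"
    using axis_orbit_escapes[OF R(2-4) d] by blast
  have "c + 1 \<le> green_plus H d (x, 0)"
  proof (rule LIMSEQ_le_const[OF LIMSEQ_Suc[OF green_plus_tendsto[OF d C]]])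
    show "\<exists>N. \<forall>n\<ge>N. c + 1 \<le> log_plus (norm ((H ^^ Suc n) (x, 0))) / real d ^ Suc n"
      using x d by (intro exI[of _ 0]) (simp add: pos_le_divide_eq)
  qed
  moreover have "green_plus H d (x, 0) \<le> c"
  proof -
    obtain M where "\<And>n. \<exists>w. norm ((H ^^ n) (x, w)) \<le> M"
      using slice_contains_bounded_orbits[OF R(2) curves \<alpha>(1) R(1)] by blast
    then obtain y where y: "green_plus H d (x, y) < c"
      using slice_meets_sublevel[OF d C _ assms(2)] by blast
    \<comment> \<open>Only the second coordinate is rotated, so one point of the sublevel set on the
      line over \<open>x\<close> yields a whole circle, reduced to a point if
      \<open>y = 0\<close>.\<close>
    have "green_plus H d (x, w) < c" if "norm w = norm y" for w
    proof -
      obtain \<theta> :: real where "w = exp (\<i> * of_real \<theta>) * y"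
      proof (cases "y = 0")
        case True
        then show thesis
          using that \<open>norm w = norm y\<close> by auto
      next
        case False
        then have "norm (w / y) = 1"
          using \<open>norm w = norm y\<close> by (simp add: norm_divide)
        then obtain \<theta> where "w / y = exp (\<i> * of_real \<theta>)"
          using complex_norm_eq_1_exp[of "w / y"] by metis
        then show thesis
          using that False by (simp add: field_simps)
      qed
      moreover have "(exp (\<i> * of_real 0) * x, exp (\<i> * of_real \<theta>) * y) \<in> {z. green_plus H d z < c}"
        using rein y unfolding reinhardt_def by blast
      ultimately show ?thesis
        by simp
    qed
    then show ?thesis
      using green_plus_center_le[OF d C curves norm_ge_zero] by blast
  qed
  ultimately show False
    by simp
qed

end
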